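(* Let $f:\mathbb{R}^n\to\mathbb{R}$ be a function. Then the binary relation $\preceq$ on $\mathbb{R}^n$ associated with $f$ is a preorder (i.e. reflexive and transitive). If moreover $f$ is definable in an o-minimal structure on the real field, then $\preceq$ is a total preorder and $$\forall x,y\in\mathbb{R}^n,\quad x\prec y\iff \exists\,\overline r>0:\ \forall r\in(0,\overline r],\ \ \mathring f(x,r)<\mathring f(y,r).$$
   Context: For $f:\mathbb{R}^n\to\mathbb{R}$, define $\mathring f:\mathbb{R}^n\times[0,\infty)\to\mathbb{R}\cup\{\infty\}$ by $\mathring f(x,r)=\sup_{y\in\overline B_r(x)}|f(y)-f(x)|$, where $\overline B_r(x)$ is the closed Euclidean ball of center $x$ and radius $r$. The relation $\preceq$ is defined by: $x\preceq y$ iff there exists $\overline r>0$ such that $\mathring f(x,r)\le\mathring f(y,r)$ for all $r\in(0,\overline r]$. The strict relation is $x\prec y$ iff $x\preceq y$ and not $y\preceq x$. The preorder is total if any two distinct points $x,y$ satisfy $x\preceq y$ or $y\preceq x$. A function is definable if its graph is definable in a fixed, arbitrary o-minimal structure on the real field. *)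

theory Defs
  imports "HOL-Analysis.Analysis"
begin

(* The set "S n" consists of the definable subsets of R^n; points of R^n are lists of length n,
   so that products with R become appending or prepending a coordinate.  Definability is with
   parameters, because by the last axiom every singleton of R belongs to the structure. *)
locale o_minimal_structure =
  fixes S :: "nat \<Rightarrow> real list set set"
  assumes subset_space: "A \<in> S n \<Longrightarrow> A \<subseteq> {x. length x = n}"
    and space: "{x. length x = n} \<in> S n"
    and union: "A \<in> S n \<Longrightarrow> B \<in> S n \<Longrightarrow> A \<union> B \<in> S n"
    and complement: "A \<in> S n \<Longrightarrow> {x. length x = n} - A \<in> S n"
    and times_right: "A \<in> S n \<Longrightarrow> {x @ [t] |x t. x \<in> A} \<in> S (Suc n)"
    and times_left: "A \<in> S n \<Longrightarrow> {t # x |t x. x \<in> A} \<in> S (Suc n)"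
    and diagonal: "i < n \<Longrightarrow> j < n \<Longrightarrow> {x. length x = n \<and> x ! i = x ! j} \<in> S n"
    and projection: "A \<in> S (Suc n) \<Longrightarrow> butlast ` A \<in> S n"
    and graph_add: "{[a, b, a + b] |a b. True} \<in> S 3"
    and graph_mult: "{[a, b, a * b] |a b. True} \<in> S 3"
    and one_dimensional:
      "A \<in> S 1 \<longleftrightarrow>
        (\<exists>\<I>. finite \<I> \<and> (\<forall>I\<in>\<I>. (\<exists>a. I = {a}) \<or> (\<exists>a b. I = einterval a b)) \<and>
             A = (\<lambda>t. [t]) ` \<Union>\<I>)"

(* The index type 'n carries no order, so a list enumerating it fixes the order of the
   coordinates.  The choice is immaterial: structures are closed under permuting coordinates. *)
definition definable_fun :: "(nat \<Rightarrow> real list set set) \<Rightarrow> (real ^ 'n \<Rightarrow> real) \<Rightarrow> bool" where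
  "definable_fun S f \<longleftrightarrow>
    (\<exists>is. distinct is \<and> set is = (UNIV :: 'n set) \<and>
          {map (\<lambda>i. x $ i) is @ [f x] |x. True} \<in> S (Suc CARD('n)))"

definition osc :: "(real ^ 'n \<Rightarrow> real) \<Rightarrow> real ^ 'n \<Rightarrow> real \<Rightarrow> ereal" where
  "osc f x r = (SUP y\<in>cball x r. ereal \<bar>f y - f x\<bar>)"

definition flat_le :: "(real ^ 'n \<Rightarrow> real) \<Rightarrow> real ^ 'n \<Rightarrow> real ^ 'n \<Rightarrow> bool" where
  "flat_le f x y \<longleftrightarrow> (\<exists>r0>0. \<forall>r\<in>{0<..r0}. osc f x r \<le> osc f y r)"

definition flat_less :: "(real ^ 'n \<Rightarrow> real) \<Rightarrow> real ^ 'n \<Rightarrow> real ^ 'n \<Rightarrow> bool" where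
  "flat_less f x y \<longleftrightarrow> flat_le f x y \<and> \<not> flat_le f y x"

end

(* Write T x for the set of pairs (r, c) such that c < |f u - f x| for some u in the closed ball of
   radius r around x.  Then osc f x r \<le> osc f y r says that every (r, c) in T x lies in T y, and T x
   is first-order definable.  So for fixed x and y the set of such r is a finite union of points and
   intervals, hence the inequality either holds for all small r > 0 or fails for all small r > 0;
   totality and the description of the strict relation are consequences of this dichotomy. *)
theory Submission
  imports Defs
begin

section \<open>Oscillation inequalities and germs at 0 from the right\<close>

text \<open>An extended real is determined by the reals strictly below it. Quantifying over real
  \<open>c\<close> removes both the supremum and the possible value infinity, which leaves a
  first-order condition.\<close>

lemma le_osc_iff:
  "osc f x r \<le> osc f y r \<longleftrightarrow>
    (\<forall>c. (\<exists>u\<in>cball x r. c < \<bar>f u - f x\<bar>) \<longrightarrow> (\<exists>v\<in>cball y r. c < \<bar>f v - f y\<bar>))"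
proof
  assume le: "osc f x r \<le> osc f y r"
  show "\<forall>c. (\<exists>u\<in>cball x r. c < \<bar>f u - f x\<bar>) \<longrightarrow> (\<exists>v\<in>cball y r. c < \<bar>f v - f y\<bar>)"
  proof (intro allI impI)
    fix c assume "\<exists>u\<in>cball x r. c < \<bar>f u - f x\<bar>"
    then have "ereal c < osc f x r"
      by (simp add: osc_def less_SUP_iff)
    with le have "ereal c < osc f y r" by simp
    then show "\<exists>v\<in>cball y r. c < \<bar>f v - f y\<bar>"
      by (simp add: osc_def less_SUP_iff)
  qed
next
  assume imp: "\<forall>c. (\<exists>u\<in>cball x r. c < \<bar>f u - f x\<bar>) \<longrightarrow> (\<exists>v\<in>cball y r. c < \<bar>f v - f y\<bar>)"
  show "osc f x r \<le> osc f y r"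
  proof (rule ccontr)
    assume "\<not> osc f x r \<le> osc f y r"
    then obtain u where u: "u \<in> cball x r" "osc f y r < ereal \<bar>f u - f x\<bar>"
      by (auto simp: osc_def[of f x r] not_le less_SUP_iff)
    \<comment> \<open>Density supplies a real level strictly between the supremum and the value at
      \<open>u\<close>; the hypothesis speaks of real levels only.\<close>
    then obtain c where c: "osc f y r < ereal c" "c < \<bar>f u - f x\<bar>"
      using ereal_dense2[OF u(2)] by auto
    with imp u obtain v where "v \<in> cball y r" "c < \<bar>f v - f y\<bar>" by blast
    then have "ereal c < osc f y r"
      by (auto simp: osc_def less_SUP_iff)
    with c show False by simp
  qed
qed

text \<open>In filter form, conditions on small radii can be combined without choosing a common
  bound \<open>r0\<close>.\<close>

lemma flat_le_iff_eventually:
  "flat_le f x y \<longleftrightarrow> (\<forall>\<^sub>F r in at_right 0. osc f x r \<le> osc f y r)"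
  and ex_less_osc_iff_eventually:
  "(\<exists>r0>0. \<forall>r\<in>{0<..r0}. osc f x r < osc f y r) \<longleftrightarrow>
    (\<forall>\<^sub>F r in at_right 0. osc f x r < osc f y r)"
proof -
  have "(\<exists>r0>0. \<forall>r\<in>{0<..r0}. P r) \<longleftrightarrow> (\<forall>\<^sub>F r in at_right (0::real). P r)" for P
  proof
    show "\<forall>\<^sub>F r in at_right 0. P r" if "\<exists>r0>0. \<forall>r\<in>{0<..r0}. P r"
      using that by (force simp: eventually_at_right_field)
    assume "\<forall>\<^sub>F r in at_right 0. P r"
    then obtain b where "b > 0" "\<And>r. 0 < r \<Longrightarrow> r < b \<Longrightarrow> P r"
      by (auto simp: eventually_at_right_field)
    then show "\<exists>r0>0. \<forall>r\<in>{0<..r0}. P r"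
      \<comment> \<open>The filter covers only radii strictly below \<open>b\<close>, while the
        range in question includes its upper end \<open>r0\<close>.\<close>
      by (intro exI[of _ "b / 2"]) auto
  qed
  then show "flat_le f x y \<longleftrightarrow> (\<forall>\<^sub>F r in at_right 0. osc f x r \<le> osc f y r)"
    and "(\<exists>r0>0. \<forall>r\<in>{0<..r0}. osc f x r < osc f y r) \<longleftrightarrow>
      (\<forall>\<^sub>F r in at_right 0. osc f x r < osc f y r)"
    by (simp_all add: flat_le_def)
qed

lemma reflp_flat_le: "reflp (flat_le f)"
  by (auto simp: reflp_def flat_le_iff_eventually)

lemma transp_flat_le: "transp (flat_le f)"
  unfolding transp_def flat_le_iff_eventually
  by (intro allI impI, erule (1) eventually_elim2, rule order_trans)

section \<open>Finite unions of points and intervals near 0\<close>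

text \<open>The position of the endpoints relative to 0 decides: if \<open>a \<le> 0\<close> and
  \<open>0 < b\<close>, the interval contains all small positive reals; otherwise it misses all of
  them.\<close>

lemma eventually_einterval_or_not:
  "(\<forall>\<^sub>F t in at_right 0. t \<in> einterval a b) \<or> (\<forall>\<^sub>F t in at_right (0::real). t \<notin> einterval a b)"
proof -
  have pos: "\<forall>\<^sub>F t in at_right (0::real). t > 0"
    by (rule eventually_at_right_less)
  have small: "\<forall>\<^sub>F t in at_right (0::real). ereal t < c" if c: "c > 0" for c
  proof -
    \<comment> \<open>The bound \<open>c\<close> may be infinite, so a real number below it is used
      instead.\<close>
    obtain d where d: "0 < ereal d" "ereal d < c"
      using ereal_dense2[OF c] by auto
    then have "\<forall>\<^sub>F t in at_right (0::real). t < d"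
      by (auto intro: order_tendstoD(2)[OF tendsto_ident_at])
    then show ?thesis
      by eventually_elim (use d in \<open>auto intro: less_trans[of _ "ereal d"]\<close>)
  qed
  consider "a > 0" | "b \<le> 0" | "a \<le> 0" "b > 0" by fastforce
  then show ?thesis
  proof cases
    case 1
    from small[OF this] have "\<forall>\<^sub>F t in at_right 0. t \<notin> einterval a b"
      by eventually_elim (auto simp: einterval_def)
    then show ?thesis ..
  next
    case 2
    from pos have "\<forall>\<^sub>F t in at_right 0. t \<notin> einterval a b"
    proof eventually_elim
      case (elim t)
      then have "b \<le> ereal t" using 2 by (meson ereal_less(2) less_imp_le order_trans)
      then show ?case by (auto simp: einterval_def)
    qed
    then show ?thesis ..
  next
    case 3
    from pos small[OF 3(2)] have "\<forall>\<^sub>F t in at_right 0. t \<in> einterval a b"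
    proof eventually_elim
      case (elim t)
      then have "a < ereal t" using 3 by (meson ereal_less(2) le_less_trans)
      with elim show ?case by (auto simp: einterval_def)
    qed
    then show ?thesis ..
  qed
qed

text \<open>If one piece contains all small positive reals, so does the union; if every piece misses
  them, finitely many such conditions hold simultaneously.\<close>

lemma eventually_Union_or_not:
  fixes \<I> :: "real set set"
  assumes "finite \<I>" "\<forall>I\<in>\<I>. (\<exists>a. I = {a}) \<or> (\<exists>a b. I = einterval a b)"
  shows "(\<forall>\<^sub>F t in at_right 0. t \<in> \<Union>\<I>) \<or> (\<forall>\<^sub>F t in at_right 0. t \<notin> \<Union>\<I>)"
  using assms
proof (induction \<I>)
  case empty
  then show ?case by simp
next
  case (insert I \<I>)
  have "(\<forall>\<^sub>F t in at_right 0. t \<in> I) \<or> (\<forall>\<^sub>F t in at_right 0. t \<notin> I)"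
  proof -
    consider a where "I = {a}" | a b where "I = einterval a b"
      using insert.prems by auto
    then show ?thesis
    proof cases
      case 1
      \<comment> \<open>This covers \<open>a = 0\<close> as well, since \<open>at_right 0\<close>
        leaves out the point 0 itself.\<close>
      have "\<forall>\<^sub>F t in at_right 0. t \<noteq> a"
        by (rule eventually_neq_at_within)
      with 1 show ?thesis by simp
    next
      case 2
      then show ?thesis by (simp only: eventually_einterval_or_not)
    qed
  qed
  moreover have "(\<forall>\<^sub>F t in at_right 0. t \<in> \<Union>\<I>) \<or> (\<forall>\<^sub>F t in at_right 0. t \<notin> \<Union>\<I>)"
    using insert by simp
  moreover have "\<forall>\<^sub>F t in at_right 0. t \<notin> \<Union>(insert I \<I>)"
    if "\<forall>\<^sub>F t in at_right 0. t \<notin> I" "\<forall>\<^sub>F t in at_right 0. t \<notin> \<Union>\<I>"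
    using that by eventually_elim simp
  ultimately show ?case
    by (auto elim: eventually_mono)
qed

section \<open>Closure of definable predicates under first-order constructions\<close>

context o_minimal_structure
begin

text \<open>Working with predicates instead of sets turns the closure axioms into introduction rules
  that follow the shape of a formula. Values of \<open>P\<close> on lists of other lengths are
  irrelevant.\<close>

definition definable_pred :: "nat \<Rightarrow> (real list \<Rightarrow> bool) \<Rightarrow> bool" where
  "definable_pred n P \<longleftrightarrow> {x. length x = n \<and> P x} \<in> S n"

text \<open>This is definability of the graph of \<open>g\<close>, with the value stored after the
  \<open>n\<close> arguments.\<close>

definition definable_term :: "nat \<Rightarrow> (real list \<Rightarrow> real) \<Rightarrow> bool" where
  "definable_term n g \<longleftrightarrow> definable_pred (Suc n) (\<lambda>x. x ! n = g (take n x))"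

lemma definable_pred_cong:
  assumes "definable_pred n P" "\<And>x. length x = n \<Longrightarrow> P x = Q x"
  shows "definable_pred n Q"
proof -
  have "{x. length x = n \<and> P x} = {x. length x = n \<and> Q x}"
    using assms(2) by auto
  with assms(1) show ?thesis by (simp add: definable_pred_def)
qed

lemma definable_pred_mem: "A \<in> S n \<Longrightarrow> definable_pred n (\<lambda>x. x \<in> A)"
proof -
  assume A: "A \<in> S n"
  then have "{x. length x = n \<and> x \<in> A} = A" using subset_space by auto
  with A show ?thesis by (simp add: definable_pred_def)
qed

lemma definable_pred_True: "definable_pred n (\<lambda>_. True)"
  using space by (simp add: definable_pred_def)

lemma definable_pred_not: "definable_pred n P \<Longrightarrow> definable_pred n (\<lambda>x. \<not> P x)"
proof -
  assume "definable_pred n P"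
  then have "{x. length x = n} - {x. length x = n \<and> P x} \<in> S n"
    unfolding definable_pred_def by (rule complement)
  also have "{x. length x = n} - {x. length x = n \<and> P x} = {x. length x = n \<and> \<not> P x}"
    by auto
  finally show ?thesis by (simp add: definable_pred_def)
qed

lemma definable_pred_disj:
  "definable_pred n P \<Longrightarrow> definable_pred n Q \<Longrightarrow> definable_pred n (\<lambda>x. P x \<or> Q x)"
proof -
  assume "definable_pred n P" "definable_pred n Q"
  then have "{x. length x = n \<and> P x} \<union> {x. length x = n \<and> Q x} \<in> S n"
    unfolding definable_pred_def by (rule union)
  also have "{x. length x = n \<and> P x} \<union> {x. length x = n \<and> Q x} = {x. length x = n \<and> (P x \<or> Q x)}"
    by auto
  finally show ?thesis by (simp add: definable_pred_def)
qed

lemma definable_pred_conj: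
  assumes "definable_pred n P" "definable_pred n Q"
  shows "definable_pred n (\<lambda>x. P x \<and> Q x)"
  using definable_pred_not[OF definable_pred_disj[OF assms[THEN definable_pred_not]]] by simp

lemma definable_pred_all_less:
  fixes k :: nat
  shows "(\<And>i. i < k \<Longrightarrow> definable_pred n (P i)) \<Longrightarrow> definable_pred n (\<lambda>x. \<forall>i<k. P i x)"
proof (induction k)
  case 0
  then show ?case by (simp add: definable_pred_True)
next
  case (Suc k)
  then have "definable_pred n (\<lambda>x. (\<forall>i<k. P i x) \<and> P k x)"
    by (intro definable_pred_conj) auto
  then show ?case
    by (rule definable_pred_cong) (auto simp: less_Suc_eq)
qed

text \<open>Projection forgets the last coordinate, so bound variables are appended at the
  end.\<close>

lemma definable_pred_ex:
  assumes "definable_pred (Suc n) P"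
  shows "definable_pred n (\<lambda>x. \<exists>t. P (x @ [t]))"
proof -
  have "butlast ` {x. length x = Suc n \<and> P x} \<in> S n"
    using assms unfolding definable_pred_def by (rule projection)
  also have "butlast ` {x. length x = Suc n \<and> P x} = {x. length x = n \<and> (\<exists>t. P (x @ [t]))}"
  proof (intro equalityI subsetI)
    fix x assume "x \<in> butlast ` {x. length x = Suc n \<and> P x}"
    then show "x \<in> {x. length x = n \<and> (\<exists>t. P (x @ [t]))}"
      by (auto simp: length_Suc_conv_rev)
  next
    fix x assume "x \<in> {x. length x = n \<and> (\<exists>t. P (x @ [t]))}"
    then obtain t where "length x = n" "P (x @ [t])" by auto
    then show "x \<in> butlast ` {x. length x = Suc n \<and> P x}"
      by (intro image_eqI[of _ _ "x @ [t]"]) auto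
  qed
  finally show ?thesis by (simp add: definable_pred_def)
qed

lemma definable_pred_ex_list:
  "definable_pred (n + m) P \<Longrightarrow> definable_pred n (\<lambda>x. \<exists>ys. length ys = m \<and> P (x @ ys))"
proof (induction m arbitrary: P)
  case 0
  then show ?case by simp
next
  case (Suc m)
  then have "definable_pred (n + m) (\<lambda>x. \<exists>t. P (x @ [t]))"
    using definable_pred_ex[of "n + m" P] by simp
  from Suc.IH[OF this] show ?case
    by (rule definable_pred_cong) (fastforce simp: length_Suc_conv_rev)
qed

lemma definable_pred_drop:
  assumes "definable_pred m P"
  shows "definable_pred (k + m) (\<lambda>x. P (drop k x))"
proof (induction k)
  case 0
  then show ?case using assms by simp
next
  case (Suc k)
  then have "{t # x |t x. x \<in> {x. length x = k + m \<and> P (drop k x)}} \<in> S (Suc (k + m))"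
    unfolding definable_pred_def by (rule times_left)
  also have "{t # x |t x. x \<in> {x. length x = k + m \<and> P (drop k x)}} =
      {x. length x = Suc k + m \<and> P (drop (Suc k) x)}"
    by (auto simp: length_Suc_conv)
  finally show ?case by (simp add: definable_pred_def)
qed

text \<open>A fresh block of coordinates is appended, equated with the selected ones by diagonals,
  and projected away. The list \<open>js\<close> may permute, repeat or omit coordinates.\<close>

lemma definable_pred_reindex:
  assumes P: "definable_pred (length js) P" and js: "set js \<subseteq> {..<n}"
  shows "definable_pred n (\<lambda>x. P (map ((!) x) js))"
proof -
  let ?m = "length js"
  have js_less: "js ! i < n" if "i < ?m" for i
    using that js nth_mem by blast
  have "definable_pred (n + ?m) (\<lambda>z. P (drop n z) \<and> (\<forall>i<?m. z ! (n + i) = z ! (js ! i)))"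
  proof (intro definable_pred_conj definable_pred_drop P definable_pred_all_less)
    fix i assume "i < ?m"
    then show "definable_pred (n + ?m) (\<lambda>z. z ! (n + i) = z ! (js ! i))"
      unfolding definable_pred_def by (intro diagonal) (auto intro: trans_less_add1 js_less)
  qed
  from definable_pred_ex_list[OF this] show ?thesis
  proof (rule definable_pred_cong)
    fix x :: "real list" assume x: "length x = n"
    \<comment> \<open>The diagonal equations leave exactly one witness for the appended
      block.\<close>
    have "(\<forall>i<?m. (x @ ys) ! (n + i) = (x @ ys) ! (js ! i)) \<longleftrightarrow> ys = map ((!) x) js"
      if "length ys = ?m" for ys
      using that x js_less by (auto simp: list_eq_iff_nth_eq nth_append)
    then show "(\<exists>ys. length ys = ?m \<and> P (drop n (x @ ys)) \<and>
        (\<forall>i<?m. (x @ ys) ! (n + i) = (x @ ys) ! (js ! i))) = P (map ((!) x) js)"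
      using x by (auto simp: nth_append js_less intro!: exI[of _ "map ((!) x) js"])
  qed
qed

section \<open>Definable terms, substitution and atomic formulas\<close>

lemma map_nth_upt: "k \<le> length x \<Longrightarrow> map ((!) x) [0..<k] = take k x"
  by (simp add: list_eq_iff_nth_eq)

text \<open>Reindexing along \<open>[0..<n] @ [i]\<close> lets any coordinate play the role of the
  value in the graph of \<open>g\<close>.\<close>

lemma definable_pred_term_eq:
  assumes g: "definable_term n g" and "n \<le> k" "i < k"
  shows "definable_pred k (\<lambda>x. x ! i = g (take n x))"
proof -
  have "definable_pred k
      (\<lambda>x. map ((!) x) ([0..<n] @ [i]) ! n = g (take n (map ((!) x) ([0..<n] @ [i]))))"
    using assms by (intro definable_pred_reindex) (auto simp: definable_term_def)
  then show ?thesis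
    by (rule definable_pred_cong) (use assms in \<open>simp add: map_nth_upt nth_append\<close>)
qed

lemma definable_term_take:
  assumes "definable_term n g" "n \<le> k"
  shows "definable_term k (\<lambda>x. g (take n x))"
proof -
  have "definable_pred (Suc k) (\<lambda>x. x ! k = g (take n x))"
    using assms by (intro definable_pred_term_eq) auto
  then show ?thesis
    unfolding definable_term_def by (rule definable_pred_cong) (use assms in simp)
qed

text \<open>The elimination of \<open>definable_pred_reindex\<close> is repeated with graphs of
  terms in place of diagonals.\<close>

lemma definable_pred_subst:
  assumes P: "definable_pred (length gs) P" and gs: "\<forall>g\<in>set gs. definable_term n g"
  shows "definable_pred n (\<lambda>x. P (map (\<lambda>g. g x) gs))"
proof -
  let ?m = "length gs"
  have "definable_pred (n + ?m) (\<lambda>z. P (drop n z) \<and> (\<forall>i<?m. z ! (n + i) = (gs ! i) (take n z)))"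
    by (intro definable_pred_conj definable_pred_drop P definable_pred_all_less
        definable_pred_term_eq) (use gs in auto)
  from definable_pred_ex_list[OF this] show ?thesis
  proof (rule definable_pred_cong)
    fix x :: "real list" assume x: "length x = n"
    have "(\<forall>i<?m. (x @ ys) ! (n + i) = (gs ! i) (take n (x @ ys))) \<longleftrightarrow> ys = map (\<lambda>g. g x) gs"
      if "length ys = ?m" for ys
      using that x by (auto simp: list_eq_iff_nth_eq nth_append)
    then show "(\<exists>ys. length ys = ?m \<and> P (drop n (x @ ys)) \<and>
        (\<forall>i<?m. (x @ ys) ! (n + i) = (gs ! i) (take n (x @ ys)))) = P (map (\<lambda>g. g x) gs)"
      using x by (auto intro!: exI[of _ "map (\<lambda>g. g x) gs"])
  qed
qed

lemma definable_term_nth: "i < n \<Longrightarrow> definable_term n (\<lambda>x. x ! i)"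
  unfolding definable_term_def
  by (rule definable_pred_cong[of _ "\<lambda>x. x ! n = x ! i"])
    (auto simp: definable_pred_def intro: diagonal)

text \<open>Real parameters enter here: the one-dimensional axiom makes every singleton
  definable.\<close>

lemma definable_term_const: "definable_term n (\<lambda>_. c)"
proof -
  have "{[c]} \<in> S 1"
    unfolding one_dimensional by (rule exI[of _ "{{c}}"]) auto
  then have "definable_pred (length [n]) (\<lambda>x. x \<in> {[c]})"
    using definable_pred_mem[of "{[c]}" 1] by simp
  then have "definable_pred (Suc n) (\<lambda>x. map ((!) x) [n] \<in> {[c]})"
    by (rule definable_pred_reindex) simp
  then show ?thesis by (simp add: definable_term_def)
qed

text \<open>The graph of the composite is the preimage of the graph of \<open>F\<close> under the
  two argument terms and the value coordinate.\<close>

lemma definable_term_binary: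
  assumes graph: "{[a, b, F a b] |a b. True} \<in> S 3"
    and g: "definable_term n g" and h: "definable_term n h"
  shows "definable_term n (\<lambda>x. F (g x) (h x))"
proof -
  have "definable_pred (Suc n) (\<lambda>x. map (\<lambda>g. g x)
      [\<lambda>x. g (take n x), \<lambda>x. h (take n x), \<lambda>x. x ! n] \<in> {[a, b, F a b] |a b. True})"
    using definable_pred_mem[OF graph] g h
    by (intro definable_pred_subst)
      (auto simp: numeral_3_eq_3 intro: definable_term_take definable_term_nth)
  then show ?thesis by (simp add: definable_term_def)
qed

lemmas definable_term_add = definable_term_binary[OF graph_add]
lemmas definable_term_mult = definable_term_binary[OF graph_mult]

lemma definable_term_diff:
  assumes "definable_term n g" "definable_term n h"
  shows "definable_term n (\<lambda>x. g x - h x)"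
  using definable_term_add[OF assms(1)
      definable_term_mult[OF definable_term_const[of n "- 1"] assms(2)]]
  by simp

lemma definable_term_sum:
  fixes k :: nat
  shows "(\<And>j. j < k \<Longrightarrow> definable_term n (g j)) \<Longrightarrow> definable_term n (\<lambda>x. \<Sum>j<k. g j x)"
  by (induction k) (auto intro: definable_term_const definable_term_add)

text \<open>The order is recovered from the positive half-line, which is an interval and hence
  definable, by pulling it back along \<open>h x - g x\<close>.\<close>

lemma definable_pred_less:
  assumes "definable_term n g" "definable_term n h"
  shows "definable_pred n (\<lambda>x. g x < h x)"
proof -
  have "{0<..} = einterval 0 \<infinity>"
    by (auto simp: einterval_def)
  then have "(\<lambda>t::real. [t]) ` {0<..} \<in> S 1"
    unfolding one_dimensional by (intro exI[of _ "{einterval 0 \<infinity>}"]) auto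
  then have "definable_pred (length [\<lambda>x. h x - g x]) (\<lambda>x. x \<in> (\<lambda>t::real. [t]) ` {0<..})"
    by (simp add: definable_pred_mem)
  then have "definable_pred n
      (\<lambda>x. map (\<lambda>g. g x) [\<lambda>x. h x - g x] \<in> (\<lambda>t::real. [t]) ` {0<..})"
    by (rule definable_pred_subst) (use assms in \<open>auto intro: definable_term_diff\<close>)
  then show ?thesis
    by (rule definable_pred_cong) auto
qed

lemma definable_pred_le:
  assumes "definable_term n g" "definable_term n h"
  shows "definable_pred n (\<lambda>x. g x \<le> h x)"
  using definable_pred_not[OF definable_pred_less[OF assms(2,1)]] by (simp add: not_less)

section \<open>O-minimality and the dichotomy for oscillations\<close>

text \<open>The forward direction of \<open>one_dimensional\<close> gives a finite union of points
  and intervals, which cannot change membership arbitrarily close to 0.\<close>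

lemma eventually_definable_or_not:
  assumes "definable_pred 1 P"
  shows "(\<forall>\<^sub>F t in at_right 0. P [t]) \<or> (\<forall>\<^sub>F t in at_right 0. \<not> P [t])"
proof -
  obtain \<I> where \<I>: "finite \<I>" "\<forall>I\<in>\<I>. (\<exists>a. I = {a}) \<or> (\<exists>a b. I = einterval a b)"
    and eq: "{x. length x = 1 \<and> P x} = (\<lambda>t. [t]) ` \<Union>\<I>"
    using assms unfolding definable_pred_def one_dimensional by blast
  have "P [t] \<longleftrightarrow> t \<in> \<Union>\<I>" for t
  proof -
    have "P [t] \<longleftrightarrow> [t] \<in> {x. length x = 1 \<and> P x}" by simp
    also have "\<dots> \<longleftrightarrow> t \<in> \<Union>\<I>" unfolding eq by blast
    finally show ?thesis .
  qed
  with eventually_Union_or_not[OF \<I>] show ?thesis by simp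
qed

text \<open>The coordinates of \<open>z\<close> are the radius and the level. The point
  \<open>u\<close> and its value are bound together as one block constrained to the graph of
  \<open>f\<close>; \<open>x\<close> and \<open>f x\<close> are parameters.\<close>

lemma definable_pred_less_osc:
  fixes f :: "real ^ 'n \<Rightarrow> real"
  assumes "definable_fun S f"
  shows "definable_pred 2 (\<lambda>z. \<exists>u\<in>cball x (z ! 0). z ! 1 < \<bar>f u - f x\<bar>)"
proof -
  obtain js where js: "distinct js" "set js = (UNIV :: 'n set)"
    and G: "{map (\<lambda>i. x $ i) js @ [f x] |x. True} \<in> S (Suc CARD('n))"
    using assms by (auto simp: definable_fun_def)
  define N where "N = CARD('n)"
  have len: "length js = N"
    using js distinct_card[of js] by (simp add: N_def)
  \<comment> \<open>Coordinates are listed by position in \<open>js\<close>; this turns the sum over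
    positions into the sum over the index type in the Euclidean distance.\<close>
  have bij: "bij_betw ((!) js) {..<N} UNIV"
    using bij_betw_nth[OF js(1), of "{..<N}" UNIV] js(2) len by simp
  let ?G = "{map (\<lambda>i. x $ i) js @ [f x] |x. True}"
  let ?sq = "\<lambda>z::real list. \<Sum>j<N. (z ! (2 + j) - x $ (js ! j)) * (z ! (2 + j) - x $ (js ! j))"
  \<comment> \<open>After radius and level come the \<open>N\<close> coordinates of
    \<open>u\<close>, then its value at position \<open>2 + N\<close>. Distances are compared
    through squares, so \<open>0 \<le> z ! 0\<close> must be required: a ball of negative radius is
    empty. The disjunction expresses the absolute value.\<close>
  define Q where "Q z \<longleftrightarrow> drop 2 z \<in> ?G \<and> 0 \<le> z ! 0 \<and> ?sq z \<le> z ! 0 * z ! 0 \<and>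
      (z ! 1 < z ! (2 + N) - f x \<or> z ! 1 < f x - z ! (2 + N))" for z
  have "definable_pred (2 + Suc N) Q"
    unfolding Q_def
    by (intro definable_pred_conj definable_pred_disj definable_pred_drop definable_pred_less
        definable_pred_le definable_term_sum definable_term_mult definable_term_diff
        definable_term_const definable_term_nth definable_pred_mem)
      (use G in \<open>auto simp: N_def\<close>)
  from definable_pred_ex_list[OF this] show ?thesis
  proof (rule definable_pred_cong)
    fix z :: "real list" assume z: "length z = 2"
    have Q: "Q (z @ map (\<lambda>i. u $ i) js @ [f u]) \<longleftrightarrow> u \<in> cball x (z ! 0) \<and> z ! 1 < \<bar>f u - f x\<bar>" for u
    proof -
      define w where "w = z @ map (\<lambda>i. u $ i) js @ [f u]"
      have w: "drop 2 w \<in> ?G" "w ! 0 = z ! 0" "w ! 1 = z ! 1" "w ! (2 + N) = f u"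
        using z len by (auto simp: w_def nth_append)
      have nth: "w ! (2 + j) = u $ (js ! j)" if "j < N" for j
        using that z len by (simp add: w_def nth_append)
      have "?sq w = (\<Sum>j<N. (u $ (js ! j) - x $ (js ! j))\<^sup>2)"
        by (intro sum.cong refl) (simp only: lessThan_iff nth power2_eq_square)
      also have "\<dots> = (\<Sum>i\<in>UNIV. (u $ i - x $ i)\<^sup>2)"
        by (rule sum.reindex_bij_betw[OF bij])
      also have "\<dots> = (dist x u)\<^sup>2"
        by (simp add: power2_commute[of "u $ _"] dist_vec_def L2_set_def dist_real_def sum_nonneg)
      finally have "(0 \<le> z ! 0 \<and> ?sq w \<le> z ! 0 * z ! 0) \<longleftrightarrow> u \<in> cball x (z ! 0)"
        by (auto simp: power2_eq_square[symmetric] intro: power2_le_imp_le power_mono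
            order_trans[OF zero_le_dist])
      moreover have "z ! 1 < \<bar>f u - f x\<bar> \<longleftrightarrow> z ! 1 < f u - f x \<or> z ! 1 < f x - f u"
        by auto
      ultimately have "Q w \<longleftrightarrow> u \<in> cball x (z ! 0) \<and> z ! 1 < \<bar>f u - f x\<bar>"
        using w(1) unfolding Q_def w(2-4) by argo
      then show ?thesis by (simp only: w_def)
    qed
    show "(\<exists>ys. length ys = Suc N \<and> Q (z @ ys)) \<longleftrightarrow> (\<exists>u\<in>cball x (z ! 0). z ! 1 < \<bar>f u - f x\<bar>)"
    proof
      assume "\<exists>ys. length ys = Suc N \<and> Q (z @ ys)"
      then obtain ys where ys: "Q (z @ ys)" by auto
      \<comment> \<open>Lying on the graph forces the block to encode an actual point together with
        its value.\<close>
      then have "ys \<in> ?G" using z by (simp add: Q_def)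
      then obtain u where "ys = map (\<lambda>i. u $ i) js @ [f u]" by auto
      with ys Q show "\<exists>u\<in>cball x (z ! 0). z ! 1 < \<bar>f u - f x\<bar>" by auto
    next
      assume "\<exists>u\<in>cball x (z ! 0). z ! 1 < \<bar>f u - f x\<bar>"
      then obtain u where "Q (z @ map (\<lambda>i. u $ i) js @ [f u])" using Q by blast
      then show "\<exists>ys. length ys = Suc N \<and> Q (z @ ys)"
        using len by (intro exI[of _ "map (\<lambda>i. u $ i) js @ [f u]"]) auto
    qed
  qed
qed

text \<open>By \<open>le_osc_iff\<close> the inequality is a definable condition on \<open>r\<close>
  alone, so it holds for all small radii or fails for all of them; failure is strict inequality
  because \<open>ereal\<close> is linearly ordered.\<close>

lemma eventually_osc_le_or_less:
  assumes "definable_fun S f"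
  shows "(\<forall>\<^sub>F r in at_right 0. osc f x r \<le> osc f y r) \<or> (\<forall>\<^sub>F r in at_right 0. osc f y r < osc f x r)"
proof -
  let ?T = "\<lambda>x z. \<exists>u\<in>cball x (z ! 0). z ! Suc 0 < \<bar>f u - f x\<bar>"
  have "definable_pred 2 (\<lambda>z. ?T x z \<and> \<not> ?T y z)"
    using definable_pred_less_osc[OF assms]
    by (intro definable_pred_conj definable_pred_not) auto
  \<comment> \<open>The universal quantifier over levels becomes a negated existential, with the
    level as the last coordinate.\<close>
  then have "definable_pred 1 (\<lambda>z. \<not> (\<exists>c. ?T x (z @ [c]) \<and> \<not> ?T y (z @ [c])))"
    by (intro definable_pred_not definable_pred_ex) (simp add: numeral_2_eq_2)
  from eventually_definable_or_not[OF this]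
  have "(\<forall>\<^sub>F r in at_right 0. osc f x r \<le> osc f y r) \<or>
      (\<forall>\<^sub>F r in at_right 0. \<not> osc f x r \<le> osc f y r)"
    by (simp add: le_osc_iff imp_conv_disj)
  then show ?thesis by (simp add: not_le)
qed

end

theorem fact3p3:
  fixes f :: "real ^ 'n \<Rightarrow> real"
  shows "(reflp (flat_le f) \<and> transp (flat_le f)) \<and>
    (\<forall>S. o_minimal_structure S \<and> definable_fun S f \<longrightarrow>
      (reflp (flat_le f) \<and> transp (flat_le f) \<and> totalp (flat_le f)) \<and>
      (\<forall>x y. flat_less f x y \<longleftrightarrow> (\<exists>r0>0. \<forall>r\<in>{0<..r0}. osc f x r < osc f y r)))"
proof (intro conjI allI impI reflp_flat_le transp_flat_le; elim conjE)
  fix S assume S: "o_minimal_structure S" "definable_fun S f"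
  note dichotomy = o_minimal_structure.eventually_osc_le_or_less[OF S]
  \<comment> \<open>The strict alternative of the dichotomy, once weakened, is the reverse
    relation.\<close>
  show "totalp (flat_le f)"
    unfolding totalp_on_def flat_le_iff_eventually
    using dichotomy by (metis (mono_tags, lifting) eventually_mono less_imp_le)
  fix x y
  show "flat_less f x y \<longleftrightarrow> (\<exists>r0>0. \<forall>r\<in>{0<..r0}. osc f x r < osc f y r)"
    unfolding flat_less_def flat_le_iff_eventually ex_less_osc_iff_eventually
  proof
    assume "(\<forall>\<^sub>F r in at_right 0. osc f x r \<le> osc f y r) \<and>
      \<not> (\<forall>\<^sub>F r in at_right 0. osc f y r \<le> osc f x r)"
    then show "\<forall>\<^sub>F r in at_right 0. osc f x r < osc f y r"
      \<comment> \<open>With the points swapped, the second conjunct excludes the first alternative,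
        and the other one is the goal.\<close>
      using dichotomy[of y x] by blast
  next
    assume less: "\<forall>\<^sub>F r in at_right 0. osc f x r < osc f y r"
    have "\<not> (\<forall>\<^sub>F r in at_right 0. osc f y r \<le> osc f x r)"
    proof
      assume "\<forall>\<^sub>F r in at_right 0. osc f y r \<le> osc f x r"
      \<comment> \<open>Both conditions would hold at a common small radius; the filter
        \<open>at_right 0\<close> is nontrivial, so this is absurd.\<close>
      with less have "\<forall>\<^sub>F r in at_right (0::real). False"
        by eventually_elim simp
      then show False by simp
    qed
    then show "(\<forall>\<^sub>F r in at_right 0. osc f x r \<le> osc f y r) \<and>
      \<not> (\<forall>\<^sub>F r in at_right 0. osc f y r \<le> osc f x r)"
      using less by (auto intro: less_imp_le elim: eventually_mono)
  qed
qed

end
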